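(* Let $\mathcal A=\bigoplus_{n\ge0}\mathcal A_n$ be a graded algebra with norms $\|\cdot\|_n$ on $\mathcal A_n$ as described in the context, and let $\mathcal A$ be equipped with the norm $\|F\|^2=\sum_{n\ge0}w(n)\|F_n\|_n^2$ with weights $w(n)=(n!)^\gamma$, $\gamma\le-2$. Then the product of the algebra is continuous with the uniform norm estimate $$\|F\circ G\|\le\sqrt3\,\|F\|\,\|G\|\qquad(F,G\in\mathcal A).$$
   Context: $\mathcal A=\bigoplus_{n=0}^\infty\mathcal A_n$ (algebraic direct sum) is a $\mathbb Z$-graded algebra over $\mathbb K=\mathbb R$ or $\mathbb C$: $\mathcal A_0=\mathbb K$ is spanned by the unit $e$, and the product $\circ$ maps $\mathcal A_p\times\mathcal A_q$ into $\mathcal A_{p+q}$ for all $p,q\ge0$. Each $\mathcal A_n$ carries a Hilbert norm $\|\cdot\|_n$ (on $\mathcal A_0=\mathbb K$ it is the absolute value, so $\|e\|_0=1$), and for all $p,q\ge0$, $F_p\in\mathcal A_p$, $G_q\in\mathcal A_q$: $\|F_p\circ G_q\|_{p+q}^2\le\frac{(p+q)!}{p!\,q!}\|F_p\|_p^2\|G_q\|_q^2$. For $F=\sum_nF_n$ with $F_n\in\mathcal A_n$, the norm on $\mathcal A$ is $\|F\|^2=\sum_nw(n)\|F_n\|_n^2$. *)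

theory Defs
  imports "HOL-Analysis.Analysis"
begin

text \<open>The scalar field, R or C. The axioms leave no other models: the value of \<open>kcnj\<close> at
  \<open>x \<noteq> 0\<close> is \<open>(norm x)\<^sup>2 / x\<close>, and \<open>x + kcnj x\<close> is real because
  \<open>(1 + x) * (1 + kcnj x)\<close> is, so every \<open>x\<close> is a root of a monic real quadratic.\<close>

class real_or_complex = real_normed_field +
  fixes kcnj :: "'a \<Rightarrow> 'a"
  assumes kcnj_add: "kcnj (x + y) = kcnj x + kcnj y"
    and kcnj_mult: "kcnj (x * y) = kcnj x * kcnj y"
    and kcnj_kcnj: "kcnj (kcnj x) = x"
    and mult_kcnj: "x * kcnj x = ((norm x)\<^sup>2) *\<^sub>R 1"

instantiation real :: real_or_complex
begin
definition kcnj_real :: "real \<Rightarrow> real" where "kcnj_real x = x"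
instance by standard (simp_all add: kcnj_real_def power2_eq_square)
end

instantiation complex :: real_or_complex
begin
definition kcnj_complex :: "complex \<Rightarrow> complex" where "kcnj_complex = cnj"
instance
  by standard (simp_all add: kcnj_complex_def scaleR_conv_of_real flip: complex_norm_square)
end

definition inner_product_on ::
  "('k::real_or_complex \<Rightarrow> 'a::ab_group_add \<Rightarrow> 'a) \<Rightarrow> 'a set \<Rightarrow> ('a \<Rightarrow> 'a \<Rightarrow> 'k) \<Rightarrow> bool"
where
  "inner_product_on smul V ip \<longleftrightarrow>
     (\<forall>x\<in>V. \<forall>y\<in>V. \<forall>z\<in>V. ip x (y + z) = ip x y + ip x z) \<and>
     (\<forall>x\<in>V. \<forall>y\<in>V. \<forall>c. ip x (smul c y) = c * ip x y) \<and>
     (\<forall>x\<in>V. \<forall>y\<in>V. ip y x = kcnj (ip x y)) \<and>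
     (\<forall>x\<in>V. x \<noteq> 0 \<longrightarrow> (\<exists>r>0. ip x x = of_real r))"

text \<open>A norm induced by an inner product; completeness is not required.\<close>

definition hilbert_norm_on ::
  "('k::real_or_complex \<Rightarrow> 'a::ab_group_add \<Rightarrow> 'a) \<Rightarrow> 'a set \<Rightarrow> ('a \<Rightarrow> real) \<Rightarrow> bool"
where
  "hilbert_norm_on smul V nrm \<longleftrightarrow>
     (\<exists>ip. inner_product_on smul V ip \<and>
           (\<forall>x\<in>V. 0 \<le> nrm x \<and> of_real ((nrm x)\<^sup>2) = ip x x))"

definition is_decomposition ::
  "(nat \<Rightarrow> 'a::ab_group_add set) \<Rightarrow> 'a \<Rightarrow> (nat \<Rightarrow> 'a) \<Rightarrow> bool"
where
  "is_decomposition A F f \<longleftrightarrow>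
     (\<forall>n. f n \<in> A n) \<and> finite {n. f n \<noteq> 0} \<and> F = (\<Sum>n | f n \<noteq> 0. f n)"

definition component :: "(nat \<Rightarrow> 'a::ab_group_add set) \<Rightarrow> 'a \<Rightarrow> nat \<Rightarrow> 'a" where
  "component A F = (THE f. is_decomposition A F f)"

text \<open>The whole type \<open>'a\<close> is the algebra, the internal direct sum of the subspaces \<open>A n\<close>.
  Associativity of the product is not required.\<close>

locale graded_algebra = vector_space smul
  for smul :: "'k::field \<Rightarrow> 'a::ab_group_add \<Rightarrow> 'a" +
  fixes mult :: "'a \<Rightarrow> 'a \<Rightarrow> 'a"
    and e :: 'a
    and A :: "nat \<Rightarrow> 'a set"
  assumes linear_left: "Vector_Spaces.linear smul smul (\<lambda>F. mult F G)"
    and linear_right: "Vector_Spaces.linear smul smul (\<lambda>G. mult F G)"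
    and unit_left: "mult e F = F"
    and unit_right: "mult F e = F"
    and subspace_A: "subspace (A n)"
    and direct_sum: "\<exists>!f. is_decomposition A F f"
    and unit_nonzero: "e \<noteq> 0"
    and A_0: "A 0 = span {e}"
    and mult_graded: "F \<in> A p \<Longrightarrow> G \<in> A q \<Longrightarrow> mult F G \<in> A (p + q)"

locale hilbert_graded_algebra = graded_algebra smul mult e A
  for smul :: "'k::real_or_complex \<Rightarrow> 'a::ab_group_add \<Rightarrow> 'a"
    and mult :: "'a \<Rightarrow> 'a \<Rightarrow> 'a"
    and e :: 'a
    and A :: "nat \<Rightarrow> 'a set" +
  fixes nrm :: "nat \<Rightarrow> 'a \<Rightarrow> real"
  assumes hilbert_norm: "hilbert_norm_on smul (A n) (nrm n)"
    and nrm_0: "nrm 0 (smul c e) = norm c"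
    and nrm_mult: "F \<in> A p \<Longrightarrow> G \<in> A q \<Longrightarrow>
      (nrm (p + q) (mult F G))\<^sup>2 \<le> fact (p + q) / (fact p * fact q) * (nrm p F)\<^sup>2 * (nrm q G)\<^sup>2"

definition weighted_norm ::
  "(nat \<Rightarrow> 'a::ab_group_add set) \<Rightarrow> (nat \<Rightarrow> 'a \<Rightarrow> real) \<Rightarrow> (nat \<Rightarrow> real) \<Rightarrow> 'a \<Rightarrow> real"
where
  "weighted_norm A nrm w F =
     sqrt (\<Sum>n | component A F n \<noteq> 0. w n * (nrm n (component A F n))\<^sup>2)"

definition norm_topology :: "('a::ab_group_add \<Rightarrow> real) \<Rightarrow> 'a topology" where
  "norm_topology N = Metric_space.mtopology UNIV (\<lambda>F G. N (F - G))"

end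

theory Submission
  imports Defs
begin

text \<open>Put \<open>a\<^sub>p = sqrt (w p) \<parallel>F\<^sub>p\<parallel>\<close> and \<open>b\<^sub>q = sqrt (w q) \<parallel>G\<^sub>q\<parallel>\<close>. Since \<open>\<gamma> \<le> -2\<close>, the weights
  satisfy \<open>w (p + q) (p + q choose p)\<^sup>2 \<le> w p * w q\<close>, so the degree-\<open>n\<close> part of \<open>F \<circ> G\<close>
  has weighted norm at most \<open>\<Sum>p\<le>n. a\<^sub>p b\<^sub>n\<^sub>-\<^sub>p / sqrt (n choose p)\<close>. By Cauchy-Schwarz its square is at
  most \<open>(\<Sum>p\<le>n. 1 / (n choose p)) * (\<Sum>p\<le>n. a\<^sub>p\<^sup>2 b\<^sub>n\<^sub>-\<^sub>p\<^sup>2)\<close>, and the first factor never exceeds 3.\<close>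

section \<open>Row sums of inverse binomial coefficients, and sums over antidiagonals\<close>

text \<open>Adding neighbouring inverses in row \<open>Suc n\<close> gives a fixed multiple of one
  inverse in row \<open>n\<close>. Summed over \<open>p\<close>, this counts every entry of row
  \<open>Suc n\<close> twice, except for the two end entries, which equal 1 and are counted
  once.\<close>

lemma sum_inverse_binomial_Suc:
  "(\<Sum>p\<le>Suc n. 1 / real (Suc n choose p))
     = 1 + (real n + 2) / (2 * (real n + 1)) * (\<Sum>p\<le>n. 1 / real (n choose p))"
proof -
  \<comment> \<open>Absorption expresses both neighbours through \<open>n choose p\<close>. Over the
    common denominator \<open>(n + 1) * (n choose p)\<close> the reciprocals have numerators
    \<open>n + 1 - p\<close> and \<open>p + 1\<close>, so \<open>p\<close> cancels in their
    sum.\<close>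
  have step: "1 / real (Suc n choose p) + 1 / real (Suc n choose Suc p)
      = (real n + 2) / (real n + 1) * (1 / real (n choose p))" if "p \<le> n" for p
  proof -
    have pos: "real (n choose p) > 0"
      using that by simp
    have "real (Suc p) * real (Suc n choose Suc p) = real (Suc n) * real (n choose p)"
      by (simp only: of_nat_mult[symmetric] Suc_times_binomial)
    then have e1: "real (Suc n choose Suc p) = (real n + 1) * real (n choose p) / (real p + 1)"
      by (simp add: field_simps del: binomial_Suc_Suc)
    have "(Suc n - p) * (Suc n choose p) = Suc n * (n choose p)"
      using binomial_absorb_comp[of "Suc n" p] by simp
    then have "real (Suc n - p) * real (Suc n choose p) = real (Suc n) * real (n choose p)"
      by (simp only: of_nat_mult[symmetric])
    moreover have "real (Suc n - p) = real n + 1 - real p"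
      using that by (simp add: of_nat_diff)
    ultimately have e2: "real (Suc n choose p) = (real n + 1) * real (n choose p) / (real n + 1 - real p)"
      using that by (simp add: field_simps)
    have "real p \<le> real n" using that by simp
    then show ?thesis
      unfolding e1 e2 using pos by (simp add: divide_simps)
  qed
  have "2 * (\<Sum>p\<le>Suc n. 1 / real (Suc n choose p))
      = (\<Sum>p\<le>Suc n. 1 / real (Suc n choose p)) + (\<Sum>p\<le>Suc n. 1 / real (Suc n choose p))"
    by simp
  \<comment> \<open>One copy of the sum splits off its last term, the other its first, so that the
    remaining terms pair up as in \<open>step\<close>.\<close>
  also have "\<dots> = ((\<Sum>p\<le>n. 1 / real (Suc n choose p)) + 1) + (1 + (\<Sum>p\<le>n. 1 / real (Suc n choose Suc p)))"
    by (intro arg_cong2[where f="(+)"]) (simp, subst sum.atMost_Suc_shift, simp)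
  also have "\<dots> = 2 + (\<Sum>p\<le>n. 1 / real (Suc n choose p) + 1 / real (Suc n choose Suc p))"
    by (simp only: sum.distrib)
  also have "\<dots> = 2 + (\<Sum>p\<le>n. (real n + 2) / (real n + 1) * (1 / real (n choose p)))"
    by (intro arg_cong2[where f="(+)"] sum.cong refl step) simp
  also have "\<dots> = 2 + (real n + 2) / (real n + 1) * (\<Sum>p\<le>n. 1 / real (n choose p))"
    by (simp only: sum_distrib_left)
  finally show ?thesis
    by (simp add: field_simps)
qed

text \<open>The bound 3 reproduces itself under the recurrence once the factor
  \<open>(n + 2) / (2 * (n + 1))\<close> is at most 2/3, that is, from \<open>n = 2\<close> on. The
  two earlier steps are computed exactly and give 2 and 5/2.\<close>

lemma sum_inverse_binomial_le_3: "(\<Sum>p\<le>n. 1 / real (n choose p)) \<le> 3"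
proof (induction n)
  case (Suc n)
  have small: "(\<Sum>p\<le>0. 1 / real (0 choose p)) = 1" "(\<Sum>p\<le>Suc 0. 1 / real (Suc 0 choose p)) = 2"
    by simp_all
  consider "n = 0" | "n = 1" | "n \<ge> 2" by linarith
  then show ?case
  proof cases
    case 3
    have "(real n + 2) / (2 * (real n + 1)) * (\<Sum>p\<le>n. 1 / real (n choose p))
        \<le> (real n + 2) / (2 * (real n + 1)) * 3"
      by (intro mult_left_mono Suc.IH) simp
    also have "\<dots> \<le> 2"
      using 3 by (simp add: field_simps)
    finally show ?thesis
      unfolding sum_inverse_binomial_Suc by simp
  next
    case 1
    then show ?thesis using small by simp
  next
    case 2
    then show ?thesis unfolding sum_inverse_binomial_Suc using small by simp
  qed
qed simp

text \<open>The triangle \<open>p + q \<le> 2*M\<close> contains the square with side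
  \<open>M\<close>, and \<open>h\<close> vanishes on the rest of the triangle.\<close>

lemma sum_square_eq_sum_antidiagonals:
  fixes h :: "nat \<Rightarrow> nat \<Rightarrow> 'a::comm_monoid_add"
  assumes "\<And>p q. p > M \<or> q > M \<Longrightarrow> h p q = 0"
  shows "(\<Sum>p\<le>M. \<Sum>q\<le>M. h p q) = (\<Sum>n\<le>2*M. \<Sum>p\<le>n. h p (n - p))"
proof -
  have "(\<Sum>n\<le>2*M. \<Sum>p\<le>n. h p (n - p)) = (\<Sum>(p, q) | p + q \<le> 2*M. h p q)"
    by (simp add: sum.triangle_reindex_eq)
  also have "\<dots> = (\<Sum>(p, q)\<in>{..M} \<times> {..M}. h p q)"
  proof (rule sum.mono_neutral_right)
    have "{(p, q). p + q \<le> 2*M} \<subseteq> {..2*M} \<times> {..2*M}"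
      by auto
    then show "finite {(p, q). p + q \<le> 2*M}"
      by (rule finite_subset) simp
    show "\<forall>i\<in>{(p, q). p + q \<le> 2*M} - {..M} \<times> {..M}. (case i of (p, q) \<Rightarrow> h p q) = 0"
      by (auto intro!: assms)
  qed auto
  also have "\<dots> = (\<Sum>p\<le>M. \<Sum>q\<le>M. h p q)"
    by (simp add: sum.cartesian_product)
  finally show ?thesis ..
qed

section \<open>Conjugation of scalars, and norms induced by an inner product on a subspace\<close>

lemma kcnj_0 [simp]: "kcnj (0 :: 'k::real_or_complex) = 0"
  using kcnj_add[of "0::'k" 0] by simp

lemma kcnj_uminus: "kcnj (- x) = - kcnj (x :: 'k::real_or_complex)"
  using kcnj_add[of x "- x"] by (simp add: eq_neg_iff_add_eq_0 add.commute)

lemma norm_kcnj [simp]: "norm (kcnj x) = norm (x :: 'k::real_or_complex)"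
proof (cases "x = 0")
  case False
  have "norm x * norm (kcnj x) = norm x * norm x"
    using arg_cong[OF mult_kcnj[of x], of norm] by (simp add: norm_mult power2_eq_square)
  then show ?thesis using False by simp
qed simp

context
  fixes smul :: "'k::real_or_complex \<Rightarrow> 'a::ab_group_add \<Rightarrow> 'a"
    and V :: "'a set" and nrm :: "'a \<Rightarrow> real" and ip :: "'a \<Rightarrow> 'a \<Rightarrow> 'k"
  assumes vs: "vector_space smul"
    and sub: "module.subspace smul V"
    and ip: "inner_product_on smul V ip"
    and nrm: "\<forall>x\<in>V. 0 \<le> nrm x \<and> of_real ((nrm x)\<^sup>2) = ip x x"
begin

interpretation vector_space smul by (rule vs)

private lemmas
  add = ip[unfolded inner_product_on_def, THEN conjunct1, rule_format] and
  lin = ip[unfolded inner_product_on_def, THEN conjunct2, THEN conjunct1, rule_format] and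
  sym = ip[unfolded inner_product_on_def, THEN conjunct2, THEN conjunct2, THEN conjunct1, rule_format] and
  pos = ip[unfolded inner_product_on_def, THEN conjunct2, THEN conjunct2, THEN conjunct2, rule_format]

private lemma sq: "x \<in> V \<Longrightarrow> ip x x = of_real ((nrm x)\<^sup>2)"
  using nrm by simp

lemma inner_norm_nonneg: "x \<in> V \<Longrightarrow> 0 \<le> nrm x"
  using nrm by blast

lemma inner_norm_zero: "nrm 0 = 0"
proof -
  have 0: "0 \<in> V" by (rule subspace_0[OF sub])
  have "ip 0 0 = 0" using lin[OF 0 0, of 0] by simp
  then show ?thesis using sq[OF 0] by simp
qed

lemma inner_norm_eq_0:
  assumes "x \<in> V" "nrm x = 0"
  shows "x = 0"
proof (rule ccontr)
  assume "x \<noteq> 0"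
  then obtain r where "r > 0" "ip x x = of_real r" using pos assms by blast
  then show False using sq[of x] assms by simp
qed

lemma inner_norm_uminus:
  assumes x: "x \<in> V"
  shows "nrm (- x) = nrm x"
proof -
  have m: "- x \<in> V" by (rule subspace_neg[OF sub x])
  have "ip y (- x) = - ip y x" if "y \<in> V" for y
    using lin[OF that x, of "- 1"] by simp
  then have "ip (- x) (- x) = ip x x"
    using sym[OF x m] sym[OF x x] x m by (simp add: kcnj_uminus)
  then have "(of_real ((nrm (- x))\<^sup>2) :: 'k) = of_real ((nrm x)\<^sup>2)"
    using sq x m by simp
  then have "(nrm (- x))\<^sup>2 = (nrm x)\<^sup>2"
    by (simp only: of_real_eq_iff)
  then show ?thesis
    using inner_norm_nonneg x m by simp
qed

text \<open>Cauchy-Schwarz comes first, from the nonnegative squared norm of the part of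
  \<open>x\<close> orthogonal to \<open>y\<close>; expanding the square of \<open>x + y\<close> then
  gives the triangle inequality.\<close>

lemma inner_norm_triangle:
  assumes x: "x \<in> V" and y: "y \<in> V"
  shows "nrm (x + y) \<le> nrm x + nrm y"
proof -
  have kc: "kcnj (ip v v) = ip v v" if "v \<in> V" for v
    using sym[OF that that] by simp
  have CS: "norm (ip y x) \<le> nrm x * nrm y"
  proof (cases "y = 0")
    case True
    then have "ip x y = 0" using lin[OF x y, of 0] by simp
    then have "ip y x = 0" using sym[OF x y] by simp
    then show ?thesis using inner_norm_nonneg x y by simp
  next
    case False
    then have ny: "nrm y > 0"
      using inner_norm_eq_0[OF y] inner_norm_nonneg[OF y] by fastforce
    \<comment> \<open>This coefficient makes \<open>z\<close> orthogonal to \<open>y\<close>,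
      because \<open>ip\<close> is linear in its second argument.\<close>
    define c where "c = - (ip y x / ip y y)"
    define z where "z = x + smul c y"
    have cy: "smul c y \<in> V" by (rule subspace_scale[OF sub y])
    have z: "z \<in> V" unfolding z_def by (rule subspace_add[OF sub x cy])
    have yy: "ip y y \<noteq> 0" using ny sq[OF y] by simp
    have "ip y z = ip y x + c * ip y y"
      unfolding z_def by (simp add: add lin x y cy)
    then have "ip y z = 0" using yy by (simp add: c_def)
    then have "ip z y = 0" using sym[OF y z] by simp
    then have "ip z z = ip z x"
      using add[OF z x cy] lin[OF z y, of c] by (simp flip: z_def)
    also have "\<dots> = kcnj (ip x x + c * ip x y)"
      using sym[OF x z] by (simp add: z_def add lin x y cy)
    \<comment> \<open>The outer conjugation disappears because \<open>ip z z\<close> is fixed by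
      \<open>kcnj\<close>.\<close>
    finally have "ip z z = ip x x + c * ip x y"
      using kc[OF z] by (metis kcnj_kcnj)
    also have "c * ip x y = - (ip y x * kcnj (ip y x) / ip y y)"
      using sym[OF y x] by (simp add: c_def)
    also have "\<dots> = - of_real ((norm (ip y x))\<^sup>2 / (nrm y)\<^sup>2)"
      by (simp add: mult_kcnj scaleR_conv_of_real sq[OF y])
    finally have "(of_real ((nrm z)\<^sup>2) :: 'k) = of_real ((nrm x)\<^sup>2 - (norm (ip y x))\<^sup>2 / (nrm y)\<^sup>2)"
      by (simp add: sq x z)
    then have "(nrm z)\<^sup>2 = (nrm x)\<^sup>2 - (norm (ip y x))\<^sup>2 / (nrm y)\<^sup>2"
      by (simp only: of_real_eq_iff)
    then have "(norm (ip y x))\<^sup>2 / (nrm y)\<^sup>2 \<le> (nrm x)\<^sup>2"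
      using zero_le_power2[of "nrm z"] by linarith
    then have "(norm (ip y x))\<^sup>2 \<le> (nrm x * nrm y)\<^sup>2"
      using ny by (simp add: pos_divide_le_eq power_mult_distrib)
    then show ?thesis
      using inner_norm_nonneg x y by (intro power2_le_imp_le[of "norm (ip y x)"]) simp_all
  qed
  have xy: "x + y \<in> V" by (rule subspace_add[OF sub x y])
  have ladd: "ip (x + y) v = ip x v + ip y v" if "v \<in> V" for v
    using sym[OF that xy] sym[OF that x] sym[OF that y] add[OF that x y] by (simp add: kcnj_add)
  have "ip (x + y) (x + y) = ip x x + ip y y + (ip y x + kcnj (ip y x))"
    using sym[OF y x] by (simp add: ladd[OF xy] add x y)
  then have "(of_real ((nrm (x + y))\<^sup>2) :: 'k)
      = of_real ((nrm x)\<^sup>2) + of_real ((nrm y)\<^sup>2) + (ip y x + kcnj (ip y x))"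
    by (simp add: sq x y xy)
  \<comment> \<open>Passing to norms replaces an argument with real parts: the cross term and its
    conjugate have the same norm, so together they contribute at most
    \<open>2 * norm (ip y x)\<close>.\<close>
  then have "norm (of_real ((nrm (x + y))\<^sup>2) :: 'k)
      = norm (of_real ((nrm x)\<^sup>2) + of_real ((nrm y)\<^sup>2) + (ip y x + kcnj (ip y x)))"
    by (rule arg_cong)
  also have "\<dots> \<le> norm (of_real ((nrm x)\<^sup>2) :: 'k) + norm (of_real ((nrm y)\<^sup>2) :: 'k)
      + (norm (ip y x) + norm (kcnj (ip y x)))"
    by (intro norm_triangle_mono order_refl)
  finally have "(nrm (x + y))\<^sup>2 \<le> (nrm x)\<^sup>2 + (nrm y)\<^sup>2 + 2 * norm (ip y x)"
    unfolding norm_of_real norm_kcnj by simp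
  also have "\<dots> \<le> (nrm x + nrm y)\<^sup>2"
    using CS by (simp add: power2_sum)
  finally show ?thesis
    using inner_norm_nonneg x y by (intro power2_le_imp_le[of "nrm (x + y)"]) simp_all
qed

end

section \<open>Homogeneous components and the Cauchy product\<close>

context graded_algebra
begin

lemma is_decomposition_component: "is_decomposition A F (component A F)"
  unfolding component_def by (rule theI'[OF direct_sum])

lemma component_in: "component A F n \<in> A n"
  using is_decomposition_component unfolding is_decomposition_def by blast

lemma finite_component: "finite {n. component A F n \<noteq> 0}"
  using is_decomposition_component unfolding is_decomposition_def by blast

lemma component_bound: "\<exists>M. \<forall>n>M. component A F n = 0"
  using finite_component[of F] unfolding finite_nat_set_iff_bounded_le
  by (metis (mono_tags, lifting) mem_Collect_eq not_less)

lemma sum_component: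
  assumes "\<And>n. n > M \<Longrightarrow> component A F n = 0"
  shows "F = (\<Sum>n\<le>M. component A F n)"
proof -
  have "F = (\<Sum>n | component A F n \<noteq> 0. component A F n)"
    using is_decomposition_component unfolding is_decomposition_def by blast
  also have "\<dots> = (\<Sum>n\<le>M. component A F n)"
    using assms not_le by (intro sum.mono_neutral_left) auto
  finally show ?thesis .
qed

text \<open>This is the uniqueness half of \<open>direct_sum\<close>, phrased with a degree bound
  \<open>M\<close> instead of the exact support, so that candidate families may have zero terms
  below \<open>M\<close>.\<close>

lemma component_eqI:
  assumes "\<And>n. f n \<in> A n" "\<And>n. n > M \<Longrightarrow> f n = 0" "F = (\<Sum>n\<le>M. f n)"
  shows "component A F = f"
proof -
  have fin: "{n. f n \<noteq> 0} \<subseteq> {..M}"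
    using assms(2) not_le by auto
  then have "(\<Sum>n\<le>M. f n) = (\<Sum>n | f n \<noteq> 0. f n)"
    by (intro sum.mono_neutral_right) auto
  then have "is_decomposition A F f"
    using assms finite_subset[OF fin] unfolding is_decomposition_def by simp
  then show ?thesis
    using direct_sum is_decomposition_component by blast
qed

lemma component_add: "component A (F + G) n = component A F n + component A G n"
proof -
  obtain M1 where M1: "\<And>n. n > M1 \<Longrightarrow> component A F n = 0" using component_bound[of F] by blast
  obtain M2 where M2: "\<And>n. n > M2 \<Longrightarrow> component A G n = 0" using component_bound[of G] by blast
  define M where "M = max M1 M2"
  have "component A (F + G) = (\<lambda>n. component A F n + component A G n)"
  proof (rule component_eqI[of _ M])
    show "F + G = (\<Sum>n\<le>M. component A F n + component A G n)"
      using M1 M2 sum_component[of M F] sum_component[of M G] by (simp add: sum.distrib M_def)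
  qed (auto simp: M1 M2 M_def intro: subspace_add[OF subspace_A] component_in)
  then show ?thesis by simp
qed

lemma component_uminus: "component A (- F) n = - component A F n"
proof -
  obtain M where M: "\<And>n. n > M \<Longrightarrow> component A F n = 0" using component_bound[of F] by blast
  have "component A (- F) = (\<lambda>n. - component A F n)"
  proof (rule component_eqI[of _ M])
    show "- F = (\<Sum>n\<le>M. - component A F n)"
      using sum_component[OF M] by (simp add: sum_negf)
  qed (auto simp: M intro: subspace_neg[OF subspace_A] component_in)
  then show ?thesis by simp
qed

lemma component_zero: "component A 0 n = 0"
  using component_add[of 0 0 n] by simp

lemma
  shows mult_add_left: "mult (F + F') G = mult F G + mult F' G"
    and mult_add_right: "mult F (G + G') = mult F G + mult F G'"
    and mult_zero_left: "mult 0 G = 0"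
    and mult_zero_right: "mult F 0 = 0"
    and mult_sum_left: "mult (sum f I) G = (\<Sum>i\<in>I. mult (f i) G)"
    and mult_sum_right: "mult F (sum f I) = (\<Sum>i\<in>I. mult F (f i))"
proof -
  interpret L: Vector_Spaces.linear smul smul "\<lambda>F. mult F G" by (rule linear_left)
  interpret R: Vector_Spaces.linear smul smul "mult F" by (rule linear_right)
  show "mult (F + F') G = mult F G + mult F' G" "mult F (G + G') = mult F G + mult F G'"
    "mult 0 G = 0" "mult F 0 = 0"
    "mult (sum f I) G = (\<Sum>i\<in>I. mult (f i) G)" "mult F (sum f I) = (\<Sum>i\<in>I. mult F (f i))"
    by (rule L.add R.add L.zero R.zero L.sum R.sum)+
qed

text \<open>Bilinearity expands the product into a double sum over a square, which is regrouped by
  total degree. Each antidiagonal sum lies in the right \<open>A n\<close> by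
  \<open>mult_graded\<close>, so uniqueness of the decomposition applies.\<close>

lemma component_mult:
  "component A (mult F G) n = (\<Sum>p\<le>n. mult (component A F p) (component A G (n - p)))"
proof -
  obtain M1 where M1: "\<And>n. n > M1 \<Longrightarrow> component A F n = 0" using component_bound[of F] by blast
  obtain M2 where M2: "\<And>n. n > M2 \<Longrightarrow> component A G n = 0" using component_bound[of G] by blast
  define M where "M = max M1 M2"
  have M: "n > M \<Longrightarrow> component A F n = 0" "n > M \<Longrightarrow> component A G n = 0" for n
    by (auto simp: M1 M2 M_def)
  define h where "h p q = mult (component A F p) (component A G q)" for p q
  have h0: "h p q = 0" if "p > M \<or> q > M" for p q
    using that by (auto simp: h_def M mult_zero_left mult_zero_right)
  have "component A (mult F G) = (\<lambda>n. \<Sum>p\<le>n. h p (n - p))"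
  proof (rule component_eqI[of _ "2 * M"])
    have "mult F G = mult (\<Sum>p\<le>M. component A F p) (\<Sum>q\<le>M. component A G q)"
      using sum_component[OF M(1)] sum_component[OF M(2)] by simp
    also have "\<dots> = (\<Sum>p\<le>M. \<Sum>q\<le>M. h p q)"
      by (simp add: mult_sum_left mult_sum_right h_def) (rule sum.swap)
    also have "\<dots> = (\<Sum>n\<le>2*M. \<Sum>p\<le>n. h p (n - p))"
      by (rule sum_square_eq_sum_antidiagonals[OF h0])
    finally show "mult F G = (\<Sum>n\<le>2*M. \<Sum>p\<le>n. h p (n - p))" .
    show "(\<Sum>p\<le>n. h p (n - p)) \<in> A n" for n
    proof (rule subspace_sum[OF subspace_A])
      fix p assume "p \<in> {..n}"
      then show "h p (n - p) \<in> A n"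
        using mult_graded[OF component_in component_in, of F p G "n - p"] by (simp add: h_def)
    qed
    show "(\<Sum>p\<le>n. h p (n - p)) = 0" if "n > 2 * M" for n
      using that by (intro sum.neutral ballI h0) auto
  qed
  then show ?thesis by (simp add: h_def)
qed

end

section \<open>The weighted norm for arbitrary positive weights\<close>

context hilbert_graded_algebra
begin

lemma
  shows nrm_nonneg: "x \<in> A n \<Longrightarrow> 0 \<le> nrm n x"
    and nrm_zero: "nrm n 0 = 0"
    and nrm_eq_0: "x \<in> A n \<Longrightarrow> nrm n x = 0 \<Longrightarrow> x = 0"
    and nrm_uminus: "x \<in> A n \<Longrightarrow> nrm n (- x) = nrm n x"
    and nrm_triangle: "x \<in> A n \<Longrightarrow> y \<in> A n \<Longrightarrow> nrm n (x + y) \<le> nrm n x + nrm n y"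
proof -
  obtain ip where ip: "inner_product_on smul (A n) ip"
    "\<forall>x\<in>A n. 0 \<le> nrm n x \<and> of_real ((nrm n x)\<^sup>2) = ip x x"
    using hilbert_norm[of n] unfolding hilbert_norm_on_def by blast
  note hyps = vector_space_axioms subspace_A ip
  show "x \<in> A n \<Longrightarrow> 0 \<le> nrm n x" "nrm n 0 = 0" "x \<in> A n \<Longrightarrow> nrm n x = 0 \<Longrightarrow> x = 0"
    "x \<in> A n \<Longrightarrow> nrm n (- x) = nrm n x"
    "x \<in> A n \<Longrightarrow> y \<in> A n \<Longrightarrow> nrm n (x + y) \<le> nrm n x + nrm n y"
    using inner_norm_nonneg[OF hyps] inner_norm_zero[OF hyps] inner_norm_eq_0[OF hyps]
      inner_norm_uminus[OF hyps] inner_norm_triangle[OF hyps] by blast+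
qed

lemma nrm_sum_le:
  assumes "\<And>i. i \<in> I \<Longrightarrow> f i \<in> A n"
  shows "nrm n (sum f I) \<le> (\<Sum>i\<in>I. nrm n (f i))"
  using assms
proof (induction I rule: infinite_finite_induct)
  case (insert i I)
  have "nrm n (f i + sum f I) \<le> nrm n (f i) + nrm n (sum f I)"
    using insert.prems by (intro nrm_triangle subspace_sum[OF subspace_A]) auto
  then show ?case using insert by fastforce
qed (auto simp: nrm_zero)

context
  fixes w :: "nat \<Rightarrow> real"
  assumes w_pos: "\<And>n. w n > 0"
begin

text \<open>Absorbing the root of the weight turns the weighted norm into a plain Euclidean norm of
  the sequence of component norms.\<close>

definition wcomp :: "'a \<Rightarrow> nat \<Rightarrow> real" where
  "wcomp F n = sqrt (w n) * nrm n (component A F n)"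

lemma wcomp_nonneg: "0 \<le> wcomp F n"
  using w_pos[of n] nrm_nonneg[OF component_in, of n F] by (simp add: wcomp_def)

text \<open>Zero components contribute nothing, so any degree bound serves as index range. Several
  elements can thus share one range, and the inequalities for \<open>L2_set\<close> become
  applicable.\<close>

lemma weighted_norm_eq_L2_set:
  assumes "\<And>n. n > M \<Longrightarrow> component A F n = 0"
  shows "weighted_norm A nrm w F = L2_set (wcomp F) {..M}"
proof -
  have "(\<Sum>n | component A F n \<noteq> 0. w n * (nrm n (component A F n))\<^sup>2)
      = (\<Sum>n\<le>M. w n * (nrm n (component A F n))\<^sup>2)"
    using assms not_le by (intro sum.mono_neutral_left) (auto simp: nrm_zero)
  also have "\<dots> = (\<Sum>n\<le>M. (wcomp F n)\<^sup>2)"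
    using w_pos by (simp add: wcomp_def power_mult_distrib less_imp_le)
  finally show ?thesis by (simp add: weighted_norm_def L2_set_def)
qed

lemma weighted_norm_nonneg: "0 \<le> weighted_norm A nrm w F"
  unfolding weighted_norm_def using w_pos
  by (intro real_sqrt_ge_zero sum_nonneg) (simp add: less_imp_le)

lemma weighted_norm_zero: "weighted_norm A nrm w 0 = 0"
  by (simp add: weighted_norm_def component_zero)

lemma weighted_norm_eq_0:
  assumes "weighted_norm A nrm w F = 0"
  shows "F = 0"
proof -
  obtain M where M: "\<And>n. n > M \<Longrightarrow> component A F n = 0" using component_bound[of F] by blast
  have "wcomp F n = 0" if "n \<le> M" for n
    using assms weighted_norm_eq_L2_set[OF M] that by (simp add: L2_set_eq_0_iff)
  then have "component A F n = 0" if "n \<le> M" for n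
    using that w_pos[of n] by (intro nrm_eq_0[OF component_in]) (fastforce simp: wcomp_def)
  then show ?thesis
    by (subst sum_component[OF M]) (auto intro: sum.neutral)
qed

lemma weighted_norm_uminus: "weighted_norm A nrm w (- F) = weighted_norm A nrm w F"
  by (simp add: weighted_norm_def component_uminus nrm_uminus component_in)

text \<open>The triangle inequality in each degree is followed by Minkowski's inequality across the
  degrees.\<close>

lemma weighted_norm_triangle:
  "weighted_norm A nrm w (F + G) \<le> weighted_norm A nrm w F + weighted_norm A nrm w G"
proof -
  obtain M1 where M1: "\<And>n. n > M1 \<Longrightarrow> component A F n = 0" using component_bound[of F] by blast
  obtain M2 where M2: "\<And>n. n > M2 \<Longrightarrow> component A G n = 0" using component_bound[of G] by blast
  define M where "M = max M1 M2"
  have M: "n > M \<Longrightarrow> component A F n = 0" "n > M \<Longrightarrow> component A G n = 0" for n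
    by (auto simp: M1 M2 M_def)
  have "weighted_norm A nrm w (F + G) = L2_set (wcomp (F + G)) {..M}"
    by (rule weighted_norm_eq_L2_set) (simp add: component_add M)
  also have "\<dots> \<le> L2_set (\<lambda>n. wcomp F n + wcomp G n) {..M}"
  proof (rule L2_set_mono)
    show "wcomp (F + G) n \<le> wcomp F n + wcomp G n" for n
      using w_pos[of n] nrm_triangle[OF component_in component_in, of n F G]
      by (simp add: wcomp_def component_add flip: distrib_left)
  qed (rule wcomp_nonneg)
  also have "\<dots> \<le> L2_set (wcomp F) {..M} + L2_set (wcomp G) {..M}"
    by (rule L2_set_triangle_ineq)
  also have "\<dots> = weighted_norm A nrm w F + weighted_norm A nrm w G"
    by (simp add: weighted_norm_eq_L2_set[OF M(1)] weighted_norm_eq_L2_set[OF M(2)])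
  finally show ?thesis .
qed

text \<open>This makes the topology in \<open>norm_topology\<close> that of a genuine metric, so the
  theory of metric spaces applies to it.\<close>

lemma Metric_space_weighted_norm: "Metric_space UNIV (\<lambda>F G. weighted_norm A nrm w (F - G))"
proof
  show "weighted_norm A nrm w (F - G) = weighted_norm A nrm w (G - F)" for F G
    using weighted_norm_uminus[of "F - G"] by simp
  show "weighted_norm A nrm w (F - G) = 0 \<longleftrightarrow> F = G" for F G
    using weighted_norm_eq_0[of "F - G"] weighted_norm_zero by auto
  show "weighted_norm A nrm w (F - H) \<le> weighted_norm A nrm w (F - G) + weighted_norm A nrm w (G - H)"
    for F G H
    using weighted_norm_triangle[of "F - G" "G - H"] by simp
qed (rule weighted_norm_nonneg)

section \<open>Joint continuity of a bounded bilinear product\<close>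

lemma continuous_map_mult:
  assumes bound: "\<And>F G. weighted_norm A nrm w (mult F G)
      \<le> C * weighted_norm A nrm w F * weighted_norm A nrm w G"
    and C: "C \<ge> 0"
  defines "T \<equiv> norm_topology (weighted_norm A nrm w)"
  shows "continuous_map (prod_topology T T) T (\<lambda>(F, G). mult F G)"
proof -
  let ?N = "weighted_norm A nrm w"
  interpret M: Metric_space UNIV "\<lambda>F G. ?N (F - G)"
    by (rule Metric_space_weighted_norm)
  have T: "T = M.mtopology" by (simp add: T_def norm_topology_def)
  have "\<exists>U. openin (prod_topology T T) U \<and> (F, G) \<in> U \<and>
      (\<forall>(F', G')\<in>U. ?N (mult F G - mult F' G') < \<epsilon>)" if "\<epsilon> > 0" for F G \<epsilon>
  proof -
    \<comment> \<open>With increments \<open>X\<close> and \<open>Y\<close> below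
      \<open>\<delta> \<le> 1\<close>, the terms \<open>mult X Y\<close>, \<open>mult F Y\<close>
      and \<open>mult X G\<close> add up to at most \<open>\<delta> * (K - 1)\<close>. The extra 1
      keeps \<open>K\<close> positive even for \<open>C = 0\<close> and makes the final estimate
      strict.\<close>
    define K where "K = C * (1 + ?N F + ?N G) + 1"
    have K: "K > 0" using C weighted_norm_nonneg by (simp add: K_def add_nonneg_pos)
    define \<delta> where "\<delta> = min 1 (\<epsilon> / K)"
    have \<delta>: "0 < \<delta>" "\<delta> \<le> 1" "\<delta> * K \<le> \<epsilon>"
      using K that by (auto simp: \<delta>_def min_def field_simps)
    have "?N (mult F G - mult F' G') < \<epsilon>" if F': "?N (F - F') < \<delta>" and G': "?N (G - G') < \<delta>" for F' G'
    proof -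
      define X Y where "X = F' - F" and "Y = G' - G"
      have N: "?N X < \<delta>" "?N Y < \<delta>"
        using F' G' weighted_norm_uminus[of X] weighted_norm_uminus[of Y] by (simp_all add: X_def Y_def)
      have "mult F' G' = mult (F + X) (G + Y)" by (simp add: X_def Y_def)
      then have "mult F' G' - mult F G = mult X Y + (mult F Y + mult X G)"
        by (simp add: mult_add_left mult_add_right)
      then have "?N (mult F G - mult F' G') = ?N (mult X Y + (mult F Y + mult X G))"
        using weighted_norm_uminus[of "mult F' G' - mult F G"] by (metis minus_diff_eq)
      also have "\<dots> \<le> ?N (mult X Y) + (?N (mult F Y) + ?N (mult X G))"
        using weighted_norm_triangle[of "mult X Y" "mult F Y + mult X G"]
          weighted_norm_triangle[of "mult F Y" "mult X G"] by linarith
      also have "\<dots> \<le> C * \<delta> * 1 + (C * ?N F * \<delta> + C * \<delta> * ?N G)"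
        using N \<delta> C weighted_norm_nonneg
        by (intro add_mono order_trans[OF bound] mult_mono mult_nonneg_nonneg) (auto simp: less_imp_le)
      also have "\<dots> < \<delta> * K"
        using \<delta> by (simp add: K_def algebra_simps)
      finally show ?thesis using \<delta> by simp
    qed
    moreover have "openin (prod_topology T T) (M.mball F \<delta> \<times> M.mball G \<delta>)"
      unfolding T by (simp add: openin_prod_Times_iff)
    moreover have "(F, G) \<in> M.mball F \<delta> \<times> M.mball G \<delta>"
      using \<delta> by (simp add: weighted_norm_zero)
    ultimately show ?thesis
      by (intro exI[of _ "M.mball F \<delta> \<times> M.mball G \<delta>"]) (auto simp: M.in_mball)
  qed
  then show ?thesis
    unfolding T M.continuous_map_to_metric by (fastforce simp: M.in_mball)
qed

section \<open>The product estimate under a growth condition on the weights\<close>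

context
  assumes w_mult: "\<And>p q. w (p + q) * (real (p + q choose p))\<^sup>2 \<le> w p * w q"
begin

text \<open>The bound \<open>nrm_mult\<close> costs one binomial factor in the squared norm, while
  \<open>w_mult\<close> pays for two. The surplus is the inverse binomial coefficient, kept as a
  separate root for Cauchy-Schwarz.\<close>

lemma wcomp_mult_le:
  "wcomp (mult F G) n \<le> (\<Sum>p\<le>n. sqrt (1 / real (n choose p)) * (wcomp F p * wcomp G (n - p)))"
proof -
  have "sqrt (w n) * nrm n (mult (component A F p) (component A G (n - p)))
      \<le> sqrt (1 / real (n choose p)) * (wcomp F p * wcomp G (n - p))" if "p \<le> n" for p
  proof -
    define q where "q = n - p"
    have n: "n = p + q" using that by (simp add: q_def)
    let ?x = "component A F p" and ?y = "component A G q" and ?B = "real (n choose p)"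
    have B: "?B > 0" using that by simp
    have "(nrm n (mult ?x ?y))\<^sup>2 \<le> ?B * (nrm p ?x)\<^sup>2 * (nrm q ?y)\<^sup>2"
      using nrm_mult[OF component_in component_in, of p q F G] binomial_fact[of p n, where ?'a = real]
      by (simp add: n)
    then have "w n * (nrm n (mult ?x ?y))\<^sup>2 \<le> w n * (?B * (nrm p ?x)\<^sup>2 * (nrm q ?y)\<^sup>2)"
      using w_pos[of n] by (simp add: less_imp_le)
    \<comment> \<open>The factor \<open>?B\<close> is split as \<open>?B\<^sup>2 * (1 / ?B)\<close>
      to expose the left side of \<open>w_mult\<close>.\<close>
    also have "\<dots> = (w n * ?B\<^sup>2) * (1 / ?B * ((nrm p ?x)\<^sup>2 * (nrm q ?y)\<^sup>2))"
      using B by (simp add: power2_eq_square)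
    also have "\<dots> \<le> (w p * w q) * (1 / ?B * ((nrm p ?x)\<^sup>2 * (nrm q ?y)\<^sup>2))"
      using w_mult[of p q] by (intro mult_right_mono) (simp_all add: n)
    also have "\<dots> = 1 / ?B * ((sqrt (w p) * nrm p ?x)\<^sup>2 * (sqrt (w q) * nrm q ?y)\<^sup>2)"
      using w_pos[of p] w_pos[of q] by (simp add: power_mult_distrib)
    finally have "sqrt (w n * (nrm n (mult ?x ?y))\<^sup>2) \<le> sqrt \<dots>"
      by (rule real_sqrt_le_mono)
    moreover have "nrm n (mult ?x ?y) \<ge> 0"
      unfolding n by (intro nrm_nonneg mult_graded component_in)
    ultimately show ?thesis
      using wcomp_nonneg[of F p] wcomp_nonneg[of G q]
      unfolding real_sqrt_mult by (simp add: wcomp_def flip: q_def)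
  qed
  moreover have "nrm n (component A (mult F G) n)
      \<le> (\<Sum>p\<le>n. nrm n (mult (component A F p) (component A G (n - p))))"
    unfolding component_mult using mult_graded[OF component_in component_in]
    by (intro nrm_sum_le) (metis atMost_iff le_add_diff_inverse)
  then have "wcomp (mult F G) n
      \<le> (\<Sum>p\<le>n. sqrt (w n) * nrm n (mult (component A F p) (component A G (n - p))))"
    unfolding wcomp_def sum_distrib_left[symmetric]
    using w_pos[of n] by (intro mult_left_mono) (auto simp: less_imp_le)
  ultimately show ?thesis
    by (elim order_trans) (auto intro: sum_mono)
qed

text \<open>After Cauchy-Schwarz in each degree, the antidiagonal sums of products of squares
  reassemble into a full square, which factors into the two squared norms.\<close>

lemma weighted_norm_mult_le:
  "weighted_norm A nrm w (mult F G) \<le> sqrt 3 * weighted_norm A nrm w F * weighted_norm A nrm w G"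
proof -
  obtain M1 where M1: "\<And>n. n > M1 \<Longrightarrow> component A F n = 0" using component_bound[of F] by blast
  obtain M2 where M2: "\<And>n. n > M2 \<Longrightarrow> component A G n = 0" using component_bound[of G] by blast
  define M where "M = max M1 M2"
  have M: "n > M \<Longrightarrow> component A F n = 0" "n > M \<Longrightarrow> component A G n = 0" for n
    by (auto simp: M1 M2 M_def)
  have sq: "(wcomp (mult F G) n)\<^sup>2 \<le> 3 * (\<Sum>p\<le>n. (wcomp F p)\<^sup>2 * (wcomp G (n - p))\<^sup>2)" for n
  proof -
    have "(wcomp (mult F G) n)\<^sup>2
        \<le> (\<Sum>p\<le>n. sqrt (1 / real (n choose p)) * (wcomp F p * wcomp G (n - p)))\<^sup>2"
      by (intro power_mono wcomp_mult_le wcomp_nonneg)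
    also have "\<dots> \<le> (\<Sum>p\<le>n. (sqrt (1 / real (n choose p)))\<^sup>2) * (\<Sum>p\<le>n. (wcomp F p * wcomp G (n - p))\<^sup>2)"
      by (rule Cauchy_Schwarz_ineq_sum)
    also have "\<dots> = (\<Sum>p\<le>n. 1 / real (n choose p)) * (\<Sum>p\<le>n. (wcomp F p)\<^sup>2 * (wcomp G (n - p))\<^sup>2)"
      by (simp add: power_mult_distrib)
    also have "\<dots> \<le> 3 * (\<Sum>p\<le>n. (wcomp F p)\<^sup>2 * (wcomp G (n - p))\<^sup>2)"
      by (intro mult_right_mono sum_inverse_binomial_le_3 sum_nonneg) simp
    finally show ?thesis .
  qed
  have "component A (mult F G) n = 0" if "n > 2 * M" for n
    unfolding component_mult
  proof (intro sum.neutral ballI)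
    fix p
    have "p > M \<or> n - p > M" using that by auto
    then show "mult (component A F p) (component A G (n - p)) = 0"
      by (auto simp: M mult_zero_left mult_zero_right)
  qed
  then have "weighted_norm A nrm w (mult F G) = sqrt (\<Sum>n\<le>2*M. (wcomp (mult F G) n)\<^sup>2)"
    unfolding L2_set_def[symmetric] by (rule weighted_norm_eq_L2_set)
  also have "\<dots> \<le> sqrt (\<Sum>n\<le>2*M. 3 * (\<Sum>p\<le>n. (wcomp F p)\<^sup>2 * (wcomp G (n - p))\<^sup>2))"
    by (intro real_sqrt_le_mono sum_mono sq)
  also have "\<dots> = sqrt (3 * (\<Sum>p\<le>M. \<Sum>q\<le>M. (wcomp F p)\<^sup>2 * (wcomp G q)\<^sup>2))"
    by (subst sum_square_eq_sum_antidiagonals)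
      (auto simp: wcomp_def M nrm_zero simp flip: sum_distrib_left)
  also have "\<dots> = sqrt 3 * L2_set (wcomp F) {..M} * L2_set (wcomp G) {..M}"
    by (simp add: L2_set_def real_sqrt_mult flip: sum_product)
  also have "\<dots> = sqrt 3 * weighted_norm A nrm w F * weighted_norm A nrm w G"
    by (simp add: weighted_norm_eq_L2_set[OF M(1)] weighted_norm_eq_L2_set[OF M(2)])
  finally show ?thesis .
qed

end

end

end

section \<open>Factorial weights and the final estimate\<close>

text \<open>Writing \<open>fact (p + q)\<close> as \<open>B * (fact p * fact q)\<close> reduces the
  claim to \<open>B powr (\<gamma> + 2) \<le> 1\<close>, which holds since \<open>B \<ge> 1\<close>
  and \<open>\<gamma> + 2 \<le> 0\<close>.\<close>

lemma fact_powr_mult_binomial_le: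
  assumes "\<gamma> \<le> -2"
  shows "(fact (p + q) :: real) powr \<gamma> * (real (p + q choose p))\<^sup>2 \<le> fact p powr \<gamma> * fact q powr \<gamma>"
proof -
  define B where "B = real (p + q choose p)"
  have B: "B \<ge> 1" by (simp add: B_def Suc_le_eq)
  have "(fact (p + q) :: real) = B * (fact p * fact q)"
    unfolding B_def using binomial_fact[of p "p + q", where ?'a = real] by simp
  then have "(fact (p + q) :: real) powr \<gamma> * B\<^sup>2
      = (B powr \<gamma> * B powr 2) * (fact p powr \<gamma> * fact q powr \<gamma>)"
    using B by (simp add: powr_mult powr_numeral)
  also have "\<dots> = B powr (\<gamma> + 2) * (fact p powr \<gamma> * fact q powr \<gamma>)"
    by (simp add: powr_add)
  also have "\<dots> \<le> 1 * (fact p powr \<gamma> * fact q powr \<gamma>)"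
    using B assms powr_mono[of "\<gamma> + 2" 0 B] by (intro mult_right_mono) simp_all
  finally show ?thesis by (simp add: B_def)
qed

theorem proposition2:
  fixes smul :: "'k::real_or_complex \<Rightarrow> 'a::ab_group_add \<Rightarrow> 'a"
    and mult :: "'a \<Rightarrow> 'a \<Rightarrow> 'a"
    and e :: 'a
    and A :: "nat \<Rightarrow> 'a set"
    and nrm :: "nat \<Rightarrow> 'a \<Rightarrow> real"
    and \<gamma> :: real
    and N :: "'a \<Rightarrow> real"
  assumes "hilbert_graded_algebra smul mult e A nrm"
    and "\<gamma> \<le> -2"
    and "N = weighted_norm A nrm (\<lambda>n. fact n powr \<gamma>)"
  shows "continuous_map (prod_topology (norm_topology N) (norm_topology N)) (norm_topology N)
           (\<lambda>(F, G). mult F G)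
         \<and> (\<forall>F G. N (mult F G) \<le> sqrt 3 * N F * N G)"
proof -
  interpret hilbert_graded_algebra smul mult e A nrm by fact
  \<comment> \<open>Beyond the general estimate, what has to be checked is that the factorial
    weights are positive and satisfy \<open>w_mult\<close>; the same bound then yields continuity
    with constant \<open>sqrt 3\<close>.\<close>
  have bound: "N (mult F G) \<le> sqrt 3 * N F * N G" for F G
    unfolding assms(3)
    by (rule weighted_norm_mult_le) (simp_all add: fact_powr_mult_binomial_le assms(2))
  moreover have "continuous_map (prod_topology (norm_topology N) (norm_topology N)) (norm_topology N)
      (\<lambda>(F, G). mult F G)"
    using bound unfolding assms(3) by (intro continuous_map_mult[where C = "sqrt 3"]) simp_all
  ultimately show ?thesis by blast
qed

end
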